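(* There are contextuality scenarios $H_A$ and $H_B$ for which $$\mathcal{CE}^\infty(H_A)\otimes\mathcal{CE}^\infty(H_B)\not\subseteq\mathcal{CE}^1(H_A\otimes H_B),$$ i.e. there are $p_A\in\mathcal{CE}^\infty(H_A)$ and $p_B\in\mathcal{CE}^\infty(H_B)$ with $p_A\otimes p_B\notin\mathcal{CE}^1(H_A\otimes H_B)$.
   Context: A contextuality scenario is a hypergraph $H$ with finite nonempty vertex set $V(H)$ and edge set $E(H)\subseteq 2^{V(H)}$ such that $\bigcup_{e\in E(H)}e=V(H)$. A probabilistic model on $H$ is a map $p:V(H)\to[0,1]$ with $\sum_{v\in e}p(v)=1$ for all $e\in E(H)$; $\mathcal{G}(H)$ is the set of these. The non-orthogonality graph $\mathrm{NO}(H)$ is the simple graph on $V(H)$ in which $u,v$ are adjacent iff no edge $e\in E(H)$ satisfies $\{u,v\}\subseteq e$. The Foulis–Randall product $H_A\otimes H_B$ has vertex set $V(H_A)\times V(H_B)$ and as edges all sets $\bigcup_{a\in e_A}\{a\}\times f(a)$ with $e_A\in E(H_A)$, $f:e_A\to E(H_B)$, and all sets $\bigcup_{b\in e_B}f(b)\times\{b\}$ with $e_B\in E(H_B)$, $f:e_B\to E(H_A)$. For $p_A\in\mathcal{G}(H_A)$, $p_B\in\mathcal{G}(H_B)$, $(p_A\otimes p_B)(v_A,v_B)=p_A(v_A)p_B(v_B)$. $H^{\otimes n}$ is the iterated binary Foulis–Randall product of $n$ copies of $H$ (with any fixed bracketing), with vertex set identified with $V(H)^n$, and $p^{\otimes n}(v_1,\dots,v_n)=p(v_1)\cdots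 p(v_n)$. $\mathcal{CE}^1(H)$ is the set of $p\in\mathcal{G}(H)$ with $\sum_{v\in I}p(v)\leq 1$ for every independent set $I$ of $\mathrm{NO}(H)$. $p\in\mathcal{CE}^n(H)$ iff $p^{\otimes n}\in\mathcal{CE}^1(H^{\otimes n})$; $\mathcal{CE}^\infty(H)=\bigcap_{n\geq1}\mathcal{CE}^n(H)$. *)

theory Defs
  imports Complex_Main "HOL-Library.FuncSet" "HOL-Library.Ramsey"
begin

record 'a hypergraph =
  verts :: "'a set"
  edges :: "'a set set"

definition contextuality_scenario :: "'a hypergraph \<Rightarrow> bool" where
  "contextuality_scenario H \<longleftrightarrow>
     finite (verts H) \<and> verts H \<noteq> {} \<and> edges H \<subseteq> Pow (verts H) \<and> \<Union> (edges H) = verts H"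

text \<open>A model is represented by a total function on the vertex type whose values outside
  \<open>verts H\<close> are irrelevant: none of the sets of models below constrains them.\<close>

definition prob_models :: "'a hypergraph \<Rightarrow> ('a \<Rightarrow> real) set" where
  "prob_models H = {p \<in> verts H \<rightarrow> {0..1}. \<forall>e\<in>edges H. (\<Sum>v\<in>e. p v) = 1}"

text \<open>The edge set of the non-orthogonality graph, whose vertex set is \<open>verts H\<close>.\<close>

definition NO_edges :: "'a hypergraph \<Rightarrow> 'a set set" where
  "NO_edges H = {{u, v} | u v. u \<in> verts H \<and> v \<in> verts H \<and> u \<noteq> v \<and>
                              \<not> (\<exists>e\<in>edges H. {u, v} \<subseteq> e)}"

definition FR_product :: "'a hypergraph \<Rightarrow> 'b hypergraph \<Rightarrow> ('a \<times> 'b) hypergraph" where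
  "FR_product HA HB =
     \<lparr>verts = verts HA \<times> verts HB,
      edges = {\<Union>a\<in>eA. {a} \<times> f a | eA f. eA \<in> edges HA \<and> f \<in> eA \<rightarrow> edges HB} \<union>
              {\<Union>b\<in>eB. f b \<times> {b} | eB f. eB \<in> edges HB \<and> f \<in> eB \<rightarrow> edges HA}\<rparr>"

definition model_product :: "('a \<Rightarrow> real) \<Rightarrow> ('b \<Rightarrow> real) \<Rightarrow> 'a \<times> 'b \<Rightarrow> real" where
  "model_product pA pB = (\<lambda>(a, b). pA a * pB b)"

definition relabel :: "('a \<Rightarrow> 'b) \<Rightarrow> 'a hypergraph \<Rightarrow> 'b hypergraph" where
  "relabel g H = \<lparr>verts = g ` verts H, edges = (`) g ` edges H\<rparr>"

text \<open>The \<open>n\<close>-fold product, bracketed to the right, with \<open>(v\<^sub>1, (v\<^sub>2, \<dots>))\<close> identified with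
  the list \<open>[v\<^sub>1, v\<^sub>2, \<dots>]\<close>. Only \<open>n \<ge> 1\<close> is used; the value at \<open>0\<close> is the one-vertex unit.\<close>

fun FR_power :: "'a hypergraph \<Rightarrow> nat \<Rightarrow> 'a list hypergraph" where
  "FR_power H 0 = \<lparr>verts = {[]}, edges = {{[]}}\<rparr>"
| "FR_power H (Suc 0) = relabel (\<lambda>v. [v]) H"
| "FR_power H (Suc (Suc n)) = relabel (\<lambda>(v, vs). v # vs) (FR_product H (FR_power H (Suc n)))"

definition model_power :: "('a \<Rightarrow> real) \<Rightarrow> 'a list \<Rightarrow> real" where
  "model_power p vs = prod_list (map p vs)"

lemma verts_FR_power: "verts (FR_power H n) = {vs. length vs = n \<and> set vs \<subseteq> verts H}"
proof (induction H n rule: FR_power.induct)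
  case (2 H)
  show ?case by (auto simp: relabel_def length_Suc_conv)
next
  case (3 H n)
  show ?case
    unfolding FR_power.simps(3) relabel_def FR_product_def
    by (auto simp: 3 length_Suc_conv image_iff)
qed auto

definition CE1 :: "'a hypergraph \<Rightarrow> ('a \<Rightarrow> real) set" where
  "CE1 H = {p \<in> prob_models H. \<forall>I \<subseteq> verts H. indep I (NO_edges H) \<longrightarrow> (\<Sum>v\<in>I. p v) \<le> 1}"

definition CE :: "nat \<Rightarrow> 'a hypergraph \<Rightarrow> ('a \<Rightarrow> real) set" where
  "CE n H = {p \<in> prob_models H. model_power p \<in> CE1 (FR_power H n)}"

definition CE_inf :: "'a hypergraph \<Rightarrow> ('a \<Rightarrow> real) set" where
  "CE_inf H = (\<Inter>n\<in>{1..}. CE n H)"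

end

theory Submission
  imports Defs "HOL-Library.Numeral_Type"
begin

text \<open>
  Over a finite field \<open>F\<close>, let the vertices be all pairs \<open>(f, g)\<close> of vectors in \<open>F\<^sup>d\<close> with
  \<open>\<langle>f, g\<rangle> = 1\<close> and the edges all biorthogonal bases. The constant model \<open>1/d\<close> lies in
  \<open>CE\<^sup>\<infinity>\<close> by Haemers' rank bound on the Shannon capacity: an independent set in the
  non-orthogonality graph of the \<open>n\<close>-th power gives, by tensor products, a biorthogonal family in
  a space of dimension \<open>d\<^sup>n\<close>.

  Take \<open>d = 10\<close> over the field with 2 elements and \<open>d = 11\<close> over the field with 3 elements, and
  send a 3-subset \<open>t\<close> of a 10-set to \<open>(1\<^sub>t, 1\<^sub>t)\<close> and to \<open>((1\<^sub>t, 1), (-1\<^sub>t, 1))\<close> respectively.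
  For \<open>s \<noteq> t\<close> the images are biorthogonal over the first field if \<open>|s \<inter> t|\<close> is 0 or 2, and over
  the second if it is 1. So the 120 pairs of images form an independent set in the
  non-orthogonality graph of the product, of total weight \<open>120/110 > 1\<close>.
\<close>

section \<open>Dual families of vectors over a finite ring\<close>

definition dot :: "('s::finite \<Rightarrow> 'a::comm_ring_1) \<Rightarrow> ('s \<Rightarrow> 'a) \<Rightarrow> 'a" where
  "dot f g = (\<Sum>k\<in>UNIV. f k * g k)"

definition biorthogonal :: "('v \<Rightarrow> 's::finite \<Rightarrow> 'a::comm_ring_1) \<Rightarrow> ('v \<Rightarrow> 's \<Rightarrow> 'a) \<Rightarrow> 'v set \<Rightarrow> bool" where
  "biorthogonal x y I \<longleftrightarrow> (\<forall>u\<in>I. \<forall>v\<in>I. dot (x u) (y v) = of_bool (u = v))"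

lemma dot_sum_left: "dot (\<lambda>k. \<Sum>i\<in>I. c i * x i k) g = (\<Sum>i\<in>I. c i * dot (x i) g)"
  unfolding dot_def sum_distrib_left sum_distrib_right
  by (subst sum.swap) (simp add: mult.assoc)

lemma dot_commute: "dot f g = dot g f"
  by (simp add: dot_def mult.commute)

lemma dot_diff_left: "dot (\<lambda>k. f k - f' k) g = dot f g - dot f' g"
  by (simp add: dot_def left_diff_distrib sum_subtractf)

text \<open>Counting linear combinations replaces linear independence and dimension.\<close>

lemma card_le_if_dual_family:
  fixes x y :: "'i \<Rightarrow> 'k \<Rightarrow> 'a::{finite,comm_ring_1}"
  assumes "finite I" "finite K"
    and dual: "\<And>i j. i \<in> I \<Longrightarrow> j \<in> I \<Longrightarrow> (\<Sum>k\<in>K. x i k * y j k) = of_bool (i = j)"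
  shows "card I \<le> card K"
proof -
  \<comment> \<open>Pairing the combination \<open>\<phi> c\<close> with \<open>y j\<close> returns
    the coefficient \<open>c j\<close>, so \<phi> embeds coefficient families into vectors indexed
    by \<open>K\<close>.\<close>
  define \<phi> where "\<phi> c = restrict (\<lambda>k. \<Sum>i\<in>I. c i * x i k) K" for c :: "'i \<Rightarrow> 'a"
  have coeff: "(\<Sum>k\<in>K. \<phi> c k * y j k) = c j" if "j \<in> I" for c j
  proof -
    have "(\<Sum>k\<in>K. \<phi> c k * y j k) = (\<Sum>i\<in>I. c i * (\<Sum>k\<in>K. x i k * y j k))"
      unfolding \<phi>_def sum_distrib_left
      by (subst sum.swap) (simp add: sum_distrib_right mult.assoc)
    also have "\<dots> = (\<Sum>i\<in>I. if i = j then c i else 0)"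
      using that by (intro sum.cong) (auto simp: dual)
    finally show ?thesis
      using that \<open>finite I\<close> by simp
  qed
  have "inj_on \<phi> (I \<rightarrow>\<^sub>E UNIV)"
  proof (rule inj_onI)
    fix c d assume cd: "c \<in> I \<rightarrow>\<^sub>E UNIV" "d \<in> I \<rightarrow>\<^sub>E UNIV" "\<phi> c = \<phi> d"
    show "c = d"
    proof (rule PiE_ext[OF cd(1,2)])
      show "c j = d j" if "j \<in> I" for j
        using coeff[OF that, of c] coeff[OF that, of d] cd(3) by simp
    qed
  qed
  moreover have "\<phi> ` (I \<rightarrow>\<^sub>E UNIV) \<subseteq> K \<rightarrow>\<^sub>E UNIV"
    by (auto simp: \<phi>_def)
  ultimately have "card (I \<rightarrow>\<^sub>E (UNIV :: 'a set)) \<le> card (K \<rightarrow>\<^sub>E (UNIV :: 'a set))"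
    using \<open>finite K\<close> by (intro card_inj_on_le[of \<phi>]) (auto intro: finite_PiE)
  then have "CARD('a) ^ card I \<le> CARD('a) ^ card K"
    using assms by (simp add: card_PiE)
  \<comment> \<open>As \<open>0\<close> and \<open>1\<close> differ in the ring, the base of the two
    powers exceeds 1 and their exponents can be compared.\<close>
  moreover have "1 < CARD('a)"
    using card_mono[of UNIV "{0, 1 :: 'a}"] by simp
  ultimately show ?thesis
    by simp
qed

text \<open>The \<open>x i\<close> have at most \<open>CARD('a) ^ card I\<close> combinations, fewer
  than there are vectors, so some \<open>z\<close> escapes their span. Projecting \<open>z\<close>
  along that span leaves a nonzero \<open>f\<close> that annihilates every \<open>y i\<close>; a
  vector dual to \<open>f\<close>, projected likewise, becomes \<open>g\<close>.\<close>

lemma biorthogonal_extend: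
  fixes x y :: "'v \<Rightarrow> 's::finite \<Rightarrow> 'a::{finite,comm_ring_1}"
  assumes field: "\<And>z :: 'a. z \<noteq> 0 \<Longrightarrow> \<exists>w. z * w = 1"
    and "finite I" and small: "card I < CARD('s)" and bi: "biorthogonal x y I"
  obtains f g where "dot f g = 1" "\<And>u. u \<in> I \<Longrightarrow> dot f (y u) = 0" "\<And>u. u \<in> I \<Longrightarrow> dot (x u) g = 0"
proof -
  define \<phi> where "\<phi> c = (\<lambda>k. \<Sum>i\<in>I. c i * x i k)" for c :: "'v \<Rightarrow> 'a"
  have gt1: "1 < CARD('a)"
    using card_mono[of UNIV "{0, 1 :: 'a}"] by simp
  have "card (\<phi> ` (I \<rightarrow>\<^sub>E UNIV)) \<le> card (I \<rightarrow>\<^sub>E (UNIV :: 'a set))"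
    using \<open>finite I\<close> by (intro card_image_le finite_PiE) auto
  also have "\<dots> < CARD('s \<Rightarrow> 'a)"
    using \<open>finite I\<close> small gt1 by (simp add: card_PiE card_fun)
  finally have "\<phi> ` (I \<rightarrow>\<^sub>E UNIV) \<noteq> UNIV"
    by (metis less_irrefl)
  then obtain z where z: "z \<notin> \<phi> ` (I \<rightarrow>\<^sub>E UNIV)"
    by blast
  define f where "f = (\<lambda>k. z k - (\<Sum>i\<in>I. dot z (y i) * x i k))"
  have f_dual: "dot f (y u) = 0" if "u \<in> I" for u
  proof -
    have "dot f (y u) = dot z (y u) - (\<Sum>i\<in>I. dot z (y i) * dot (x i) (y u))"
      unfolding f_def by (simp only: dot_diff_left dot_sum_left)
    also have "(\<Sum>i\<in>I. dot z (y i) * dot (x i) (y u)) = (\<Sum>i\<in>I. if i = u then dot z (y i) else 0)"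
      using that bi by (intro sum.cong) (auto simp: biorthogonal_def)
    finally show ?thesis
      using that \<open>finite I\<close> by simp
  qed
  have "\<exists>k. f k \<noteq> 0"
  proof (rule ccontr)
    assume "\<not> (\<exists>k. f k \<noteq> 0)"
    \<comment> \<open>\<open>restrict\<close> makes the coefficients extensional, as in the domain
      whose image avoids \<open>z\<close>.\<close>
    then have "z = \<phi> (restrict (\<lambda>i. dot z (y i)) I)"
      by (auto simp: f_def \<phi>_def fun_eq_iff)
    with z show False by auto
  qed
  then obtain k w where kw: "f k * w = 1"
    using field by blast
  \<comment> \<open>A rescaled coordinate vector with \<open>dot f e = 1\<close>. Subtracting
    multiples of the \<open>y i\<close> keeps this value because \<open>f\<close> annihilates
    them.\<close>
  define e where "e = (\<lambda>j. if j = k then w else 0)"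
  define g where "g = (\<lambda>j. e j - (\<Sum>i\<in>I. dot (x i) e * y i j))"
  have dot_g: "dot h g = dot h e - (\<Sum>i\<in>I. dot (x i) e * dot h (y i))" for h
    unfolding g_def dot_commute[of h] by (simp only: dot_diff_left dot_sum_left)
  have "dot f e = 1"
    using kw by (simp add: dot_def e_def if_distrib cong: if_cong)
  then have "dot f g = 1"
    by (simp add: dot_g f_dual)
  moreover have "dot (x u) g = 0" if "u \<in> I" for u
  proof -
    have "(\<Sum>i\<in>I. dot (x i) e * dot (x u) (y i)) = (\<Sum>i\<in>I. if i = u then dot (x i) e else 0)"
      using that bi by (intro sum.cong) (auto simp: biorthogonal_def)
    then show ?thesis
      using that \<open>finite I\<close> by (simp add: dot_g)
  qed
  ultimately show ?thesis
    using that f_dual by blast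
qed

section \<open>The scenario of biorthogonal bases\<close>

text \<open>Vertices are labels \<open>v\<close> of pairs \<open>(x v, y v)\<close>, which leaves
  the vertex type free to become \<open>nat\<close> later.\<close>

definition basis_scenario ::
  "('v \<Rightarrow> 's::finite \<Rightarrow> 'a::comm_ring_1) \<Rightarrow> ('v \<Rightarrow> 's \<Rightarrow> 'a) \<Rightarrow> 'v set \<Rightarrow> 'v hypergraph" where
  "basis_scenario x y V =
     \<lparr>verts = V, edges = {e. e \<subseteq> V \<and> card e = CARD('s) \<and> biorthogonal x y e}\<rparr>"

text \<open>Missing vertices are added one at a time with \<open>biorthogonal_extend\<close>, and
  \<open>all\<close> supplies a label for each new pair. In particular, biorthogonality of two
  vertices suffices for a common edge.\<close>

lemma biorthogonal_subset_edge:
  fixes x y :: "'v \<Rightarrow> 's::finite \<Rightarrow> 'a::{finite,comm_ring_1}"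
  assumes field: "\<And>z :: 'a. z \<noteq> 0 \<Longrightarrow> \<exists>w. z * w = 1"
    and "finite V" and all: "\<And>f g. dot f g = 1 \<Longrightarrow> \<exists>v\<in>V. x v = f \<and> y v = g"
    and "I \<subseteq> V" and "biorthogonal x y I"
  shows "\<exists>e\<in>edges (basis_scenario x y V). I \<subseteq> e"
  using \<open>I \<subseteq> V\<close> \<open>biorthogonal x y I\<close>
proof (induction "CARD('s) - card I" arbitrary: I)
  case 0
  have "finite I"
    using 0 \<open>finite V\<close> finite_subset by blast
  \<comment> \<open>Truncated subtraction only yields that \<open>card I\<close> is at least
    \<open>CARD('s)\<close>; the bound on dual families gives equality.\<close>
  then have "card I \<le> CARD('s)"
    using 0 by (intro card_le_if_dual_family[of I UNIV x y]) (auto simp: biorthogonal_def dot_def)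
  with 0 show ?case
    by (auto simp: basis_scenario_def)
next
  case (Suc n)
  have "finite I"
    using Suc \<open>finite V\<close> finite_subset by blast
  moreover have "card I < CARD('s)"
    using Suc by linarith
  ultimately obtain f g where fg: "dot f g = 1" "\<And>u. u \<in> I \<Longrightarrow> dot f (y u) = 0"
      "\<And>u. u \<in> I \<Longrightarrow> dot (x u) g = 0"
    using biorthogonal_extend[OF field] Suc.prems by metis
  obtain v where v: "v \<in> V" "x v = f" "y v = g"
    using all fg(1) by blast
  \<comment> \<open>\<open>dot f\<close> takes the value 1 at \<open>y v\<close> but 0 at
    \<open>y u\<close> for every \<open>u\<close> in \<open>I\<close>.\<close>
  have "v \<notin> I"
    using fg v by force
  then have "biorthogonal x y (insert v I)"
    using Suc.prems(2) fg v by (auto simp: biorthogonal_def)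
  moreover have "n = CARD('s) - card (insert v I)"
    using Suc.hyps(2) \<open>v \<notin> I\<close> \<open>finite I\<close> by simp
  ultimately show ?case
    using Suc.hyps(1)[of "insert v I"] Suc.prems v by auto
qed

lemma contextuality_scenario_basis:
  fixes x y :: "'v \<Rightarrow> 's::finite \<Rightarrow> 'a::{finite,comm_ring_1}"
  assumes field: "\<And>z :: 'a. z \<noteq> 0 \<Longrightarrow> \<exists>w. z * w = 1"
    and "finite V" and all: "\<And>f g. dot f g = 1 \<Longrightarrow> \<exists>v\<in>V. x v = f \<and> y v = g"
    and one: "\<And>v. v \<in> V \<Longrightarrow> dot (x v) (y v) = 1"
  shows "contextuality_scenario (basis_scenario x y V)"
proof -
  have "\<exists>e\<in>edges (basis_scenario x y V). {v} \<subseteq> e" if "v \<in> V" for v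
    using biorthogonal_subset_edge[OF field \<open>finite V\<close> all, of "{v}"] that one
    by (auto simp: biorthogonal_def)
  moreover have "V \<noteq> {}"
    \<comment> \<open>A coordinate vector paired with the all-ones vector gives 1, which yields a
      vertex.\<close>
    using all[of "\<lambda>k. of_bool (k = undefined)" "\<lambda>k. 1"] by (auto simp: dot_def)
  ultimately show ?thesis
    using \<open>finite V\<close> unfolding contextuality_scenario_def basis_scenario_def by fastforce
qed

section \<open>Common edges in Foulis-Randall products and powers\<close>

text \<open>Viewing both kinds of edge as dependent sums, one of them swapped, lets the same facts
  about \<open>Sigma\<close> serve for both.\<close>

lemma edges_FR_product:
  fixes HA :: "'a hypergraph" and HB :: "'b hypergraph"
  shows "edges (FR_product HA HB) =
     {Sigma eA f | eA f. eA \<in> edges HA \<and> f \<in> eA \<rightarrow> edges HB} \<union>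
     {prod.swap ` Sigma eB f | eB f. eB \<in> edges HB \<and> f \<in> eB \<rightarrow> edges HA}"
proof -
  have "(\<Union>a\<in>eA. {a} \<times> f a) = Sigma eA f" for eA :: "'a set" and f :: "'a \<Rightarrow> 'b set"
    by auto
  moreover have "(\<Union>b\<in>eB. f b \<times> {b}) = prod.swap ` Sigma eB f" for eB :: "'b set" and f :: "'b \<Rightarrow> 'a set"
    by (auto simp: image_iff)
  ultimately show ?thesis
    by (simp add: FR_product_def)
qed

text \<open>In \<open>Sigma eA f\<close>, distinct first components share the edge
  \<open>eA\<close>; if they coincide, the second components share the edge \<open>f a\<close>. The
  other kind is symmetric.\<close>

lemma common_edge_FR_product:
  assumes "e \<in> edges (FR_product HA HB)" "(a, b) \<in> e" "(a', b') \<in> e" "(a, b) \<noteq> (a', b')"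
  shows "(a \<noteq> a' \<and> (\<exists>e\<in>edges HA. {a, a'} \<subseteq> e)) \<or> (b \<noteq> b' \<and> (\<exists>e\<in>edges HB. {b, b'} \<subseteq> e))"
  using assms unfolding edges_FR_product by (auto simp: Pi_iff)

lemma vertex_in_edge: "contextuality_scenario H \<Longrightarrow> v \<in> verts H \<Longrightarrow> \<exists>e\<in>edges H. v \<in> e"
  by (metis Union_iff contextuality_scenario_def)

text \<open>As \<open>a\<close> and \<open>a'\<close> differ, the edge placed over \<open>a\<close>
  can be chosen through \<open>b\<close> and the one over \<open>a'\<close> through
  \<open>b'\<close>, however \<open>b\<close> and \<open>b'\<close> are related.\<close>

lemma FR_product_edge_left:
  assumes "contextuality_scenario HB" "b \<in> verts HB" "b' \<in> verts HB"
    and "eA \<in> edges HA" "a \<in> eA" "a' \<in> eA" "a \<noteq> a'"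
  shows "\<exists>e\<in>edges (FR_product HA HB). {(a, b), (a', b')} \<subseteq> e"
proof -
  obtain e e' where "e \<in> edges HB" "b \<in> e" "e' \<in> edges HB" "b' \<in> e'"
    using assms(1-3) vertex_in_edge by metis
  then have "(\<lambda>i. if i = a then e else e') \<in> eA \<rightarrow> edges HB"
      "{(a, b), (a', b')} \<subseteq> Sigma eA (\<lambda>i. if i = a then e else e')"
    using assms(4-7) by auto
  with \<open>eA \<in> _\<close> show ?thesis
    unfolding edges_FR_product by (intro bexI UnI1 CollectI exI conjI) (assumption | rule refl)+
qed

lemma FR_product_edge_right:
  assumes "contextuality_scenario HA" "a \<in> verts HA" "a' \<in> verts HA"
    and "eB \<in> edges HB" "b \<in> eB" "b' \<in> eB" "b \<noteq> b'"
  shows "\<exists>e\<in>edges (FR_product HA HB). {(a, b), (a', b')} \<subseteq> e"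
proof -
  obtain e e' where "e \<in> edges HA" "a \<in> e" "e' \<in> edges HA" "a' \<in> e'"
    using assms(1-3) vertex_in_edge by metis
  then have "(\<lambda>i. if i = b then e else e') \<in> eB \<rightarrow> edges HA"
      "{(a, b), (a', b')} \<subseteq> prod.swap ` Sigma eB (\<lambda>i. if i = b then e else e')"
    using assms(4-7) by auto
  with \<open>eB \<in> _\<close> show ?thesis
    unfolding edges_FR_product by (intro bexI UnI2 CollectI exI conjI) (assumption | rule refl)+
qed

text \<open>Peeling off first letters finds a coordinate where the two words are orthogonal. That
  coordinate will make a tensor pairing vanish.\<close>

lemma common_edge_FR_power:
  assumes "e \<in> edges (FR_power H n)" "vs \<in> e" "ws \<in> e" "vs \<noteq> ws"
  shows "\<exists>(v, w)\<in>set (zip vs ws). v \<noteq> w \<and> (\<exists>e\<in>edges H. {v, w} \<subseteq> e)"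
  using assms
proof (induction H n arbitrary: e vs ws rule: FR_power.induct)
  case (2 H)
  then show ?case by (auto simp: relabel_def)
next
  case (3 H n)
  from "3.prems" obtain e' v vs' w ws' where
    "e' \<in> edges (FR_product H (FR_power H (Suc n)))" "vs = v # vs'" "ws = w # ws'"
    "(v, vs') \<in> e'" "(w, ws') \<in> e'"
    by (force simp: relabel_def)
  with common_edge_FR_product[of e' H "FR_power H (Suc n)" v vs' w ws'] "3.prems"(4)
  consider "v \<noteq> w" "\<exists>e\<in>edges H. {v, w} \<subseteq> e" |
    e where "vs' \<noteq> ws'" "e \<in> edges (FR_power H (Suc n))" "vs' \<in> e" "ws' \<in> e"
    by auto
  then show ?case
    using "3.IH" \<open>vs = _\<close> \<open>ws = _\<close> by cases fastforce+
qed auto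

section \<open>Products and powers of probabilistic models\<close>

lemma sum_model_product_Sigma:
  assumes "finite A" "\<And>a. a \<in> A \<Longrightarrow> finite (f a)"
    and "sum p A = 1" "\<And>a. a \<in> A \<Longrightarrow> sum q (f a) = 1"
  shows "sum (model_product p q) (Sigma A f) = 1"
proof -
  have "sum (model_product p q) (Sigma A f) = (\<Sum>a\<in>A. \<Sum>b\<in>f a. p a * q b)"
    using assms by (subst sum.Sigma) (auto simp: model_product_def)
  also have "\<dots> = (\<Sum>a\<in>A. p a * sum q (f a))"
    by (simp add: sum_distrib_left)
  finally show ?thesis
    using assms by simp
qed

lemma prob_models_FR_product:
  assumes "p \<in> prob_models HA" "q \<in> prob_models HB"
    and "finite (verts HA)" "finite (verts HB)"
    and "edges HA \<subseteq> Pow (verts HA)" "edges HB \<subseteq> Pow (verts HB)"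
  shows "model_product p q \<in> prob_models (FR_product HA HB)"
proof -
  have finite: "finite e" if "e \<in> edges HA" for e
    using that assms by (meson PowD finite_subset subsetD)
  have finite': "finite e" if "e \<in> edges HB" for e
    using that assms by (meson PowD finite_subset subsetD)
  have "sum (model_product p q) e = 1" if edge: "e \<in> edges (FR_product HA HB)" for e
    using edge unfolding edges_FR_product
  proof (elim UnE CollectE exE conjE)
    fix eA f assume "e = Sigma eA f" "eA \<in> edges HA" "f \<in> eA \<rightarrow> edges HB"
    then show ?thesis
      using assms(1,2) finite finite' unfolding prob_models_def
      by (auto intro!: sum_model_product_Sigma)
  next
    fix eB f assume *: "e = prod.swap ` Sigma eB f" "eB \<in> edges HB" "f \<in> eB \<rightarrow> edges HA"
    \<comment> \<open>Undoing the swap gives a dependent sum over \<open>eB\<close> with the two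
      models exchanged.\<close>
    have "sum (model_product p q) e = sum (model_product q p) (Sigma eB f)"
      unfolding *(1) by (subst sum.reindex) (auto simp: model_product_def mult.commute)
    also have "\<dots> = 1"
      using assms(1,2) * finite finite' unfolding prob_models_def
      by (auto intro!: sum_model_product_Sigma)
    finally show ?thesis .
  qed
  then show ?thesis
    using assms(1,2) by (auto simp: prob_models_def FR_product_def model_product_def Pi_iff mult_le_one)
qed

lemma prob_models_relabel:
  assumes "inj g" "p \<circ> g \<in> prob_models H"
  shows "p \<in> prob_models (relabel g H)"
  using assms
  by (auto simp: prob_models_def relabel_def sum.reindex[OF inj_on_subset[OF \<open>inj g\<close>]] Pi_iff)

lemma edges_FR_power_subset:
  assumes "edges H \<subseteq> Pow (verts H)"
  shows "edges (FR_power H n) \<subseteq> Pow (verts (FR_power H n))"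
  using assms
proof (induction H n rule: FR_power.induct)
  case (2 H)
  then show ?case by (auto simp: relabel_def)
next
  case (3 H n)
  then have "edges (FR_product H (FR_power H (Suc n))) \<subseteq> Pow (verts (FR_product H (FR_power H (Suc n))))"
    unfolding edges_FR_product by (auto simp: FR_product_def Pi_iff) blast+
  then show ?case
    unfolding FR_power.simps relabel_def by auto
qed auto

lemma finite_verts_FR_power: "finite (verts H) \<Longrightarrow> finite (verts (FR_power H n))"
  using finite_lists_length_eq[of "verts H" n] by (simp add: verts_FR_power conj_commute)

lemma prob_models_FR_power:
  assumes "p \<in> prob_models H" "finite (verts H)" "edges H \<subseteq> Pow (verts H)"
  shows "model_power p \<in> prob_models (FR_power H n)"
  using assms
proof (induction H n rule: FR_power.induct)
  case (1 H)
  then show ?case by (simp add: prob_models_def model_power_def)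
next
  case (2 H)
  then show ?case
    by (auto intro!: prob_models_relabel inj_onI simp: comp_def model_power_def)
next
  case (3 H n)
  have "model_product p (model_power p) \<in> prob_models (FR_product H (FR_power H (Suc n)))"
    using 3 by (intro prob_models_FR_product finite_verts_FR_power edges_FR_power_subset) auto
  moreover have "model_power p \<circ> (\<lambda>(v, vs). v # vs) = model_product p (model_power p)"
    by (auto simp: model_power_def model_product_def)
  ultimately show ?case
    by (auto intro!: prob_models_relabel inj_onI)
qed

section \<open>Tensor products and the rank bound\<close>

text \<open>The tensor product of the vectors of a word has one coordinate per index list
  \<open>ks\<close>. Summing over the first index separately makes the pairing of two tensors
  factor.\<close>

lemma sum_tensor_mult_tensor:
  fixes x :: "'v \<Rightarrow> 's::finite \<Rightarrow> 'a::comm_ring_1" and y :: "'w \<Rightarrow> 's \<Rightarrow> 'a"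
  assumes "length vs = length ws"
  shows "(\<Sum>ks | length ks = length vs. prod_list (map2 x vs ks) * prod_list (map2 y ws ks)) =
         prod_list (map2 (\<lambda>v w. dot (x v) (y w)) vs ws)"
  using assms
proof (induction vs ws rule: list_induct2)
  case Nil
  then show ?case by simp
next
  case (Cons v vs w ws)
  let ?t = "\<lambda>ks. prod_list (map2 x vs ks) * prod_list (map2 y ws ks)"
  have "{ks :: 's list. length ks = length (v # vs)} =
      (\<lambda>(k, ks). k # ks) ` (UNIV \<times> {ks. length ks = length vs})"
    by (auto simp: length_Suc_conv)
  then have "(\<Sum>ks | length ks = length (v # vs).
        prod_list (map2 x (v # vs) ks) * prod_list (map2 y (w # ws) ks)) =
      (\<Sum>(k, ks)\<in>UNIV \<times> {ks. length ks = length vs}. (x v k * y w k) * ?t ks)"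
    by (simp only:) (subst sum.reindex, auto intro!: inj_onI sum.cong simp: mult_ac)
  also have "\<dots> = dot (x v) (y w) * (\<Sum>ks | length ks = length vs. ?t ks)"
    unfolding dot_def sum_product sum.cartesian_product ..
  finally show ?case
    using Cons by simp
qed

lemma uniform_in_CE_inf:
  fixes x y :: "'v \<Rightarrow> 's::finite \<Rightarrow> 'a::{finite,comm_ring_1}"
  assumes "finite V" and one: "\<And>v. v \<in> V \<Longrightarrow> dot (x v) (y v) = 1"
  shows "(\<lambda>_. 1 / real CARD('s)) \<in> CE_inf (basis_scenario x y V)"
proof -
  define H where "H = basis_scenario x y V"
  define p :: "'v \<Rightarrow> real" where "p = (\<lambda>_. 1 / real CARD('s))"
  have H: "verts H = V" "edges H \<subseteq> Pow (verts H)"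
    by (auto simp: H_def basis_scenario_def)
  have p: "p \<in> prob_models H"
    by (auto simp: p_def H_def prob_models_def basis_scenario_def divide_simps)
  have "(\<Sum>vs\<in>I. model_power p vs) \<le> 1"
    if I: "I \<subseteq> verts (FR_power H n)" "indep I (NO_edges (FR_power H n))" for n I
  proof -
    let ?K = "{ks :: 's list. length ks = n}"
    have "finite I"
      using I(1) finite_verts_FR_power[of H n] \<open>finite V\<close> H finite_subset by auto
    have K: "finite ?K" "card ?K = CARD('s) ^ n"
      using finite_lists_length_eq[of "UNIV :: 's set" n] card_lists_length_eq[of "UNIV :: 's set" n]
      by auto
    have mem: "length vs = n" "set vs \<subseteq> V" if "vs \<in> I" for vs
      using I(1) that H by (auto simp: verts_FR_power)
    have "(\<Sum>ks\<in>?K. prod_list (map2 x vs ks) * prod_list (map2 y ws ks)) = of_bool (vs = ws)"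
      if "vs \<in> I" "ws \<in> I" for vs ws
    proof -
      have "(\<Sum>ks\<in>?K. prod_list (map2 x vs ks) * prod_list (map2 y ws ks)) =
          prod_list (map2 (\<lambda>v w. dot (x v) (y w)) vs ws)"
        using sum_tensor_mult_tensor[of vs ws x y] mem that by simp
      also have "\<dots> = of_bool (vs = ws)"
      proof (cases "vs = ws")
        case True
        have "prod_list (map2 (\<lambda>v w. dot (x v) (y w)) us us) = 1" if "set us \<subseteq> V" for us
          using that by (induction us) (auto simp: one)
        then show ?thesis
          using True mem that by simp
      next
        case False
        \<comment> \<open>Independence in the non-orthogonality graph means that distinct words of
          \<open>I\<close> share an edge.\<close>
        have "{vs, ws} \<notin> NO_edges (FR_power H n)"
          using I(2) that False by (simp add: indep_def)
        then have "\<exists>e\<in>edges (FR_power H n). {vs, ws} \<subseteq> e"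
          using False that I(1) unfolding NO_edges_def mem_Collect_eq by (metis subsetD)
        then obtain e where "e \<in> edges (FR_power H n)" "vs \<in> e" "ws \<in> e"
          by auto
        then obtain v w e' where "(v, w) \<in> set (zip vs ws)" "v \<noteq> w" "e' \<in> edges H" "v \<in> e'" "w \<in> e'"
          using common_edge_FR_power[of e H n vs ws] False by auto
        \<comment> \<open>Edges of \<open>H\<close> are biorthogonal sets, so this one factor
          annihilates the whole product.\<close>
        moreover from this have "dot (x v) (y w) = 0"
          by (auto simp: H_def basis_scenario_def biorthogonal_def)
        ultimately have "0 \<in> set (map2 (\<lambda>v w. dot (x v) (y w)) vs ws)"
          by force
        then have "prod_list (map2 (\<lambda>v w. dot (x v) (y w)) vs ws) = 0"
          by (metis split_list prod_list.append prod_list.Cons mult_zero_left mult_zero_right)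
        with False show ?thesis by simp
      qed
      finally show ?thesis .
    qed
    then have "card I \<le> CARD('s) ^ n"
      using card_le_if_dual_family[OF \<open>finite I\<close> K(1), of "\<lambda>vs ks. prod_list (map2 x vs ks)"
        "\<lambda>vs ks. prod_list (map2 y vs ks)"] K(2) by simp
    then have "real (card I) \<le> real CARD('s) ^ n"
      by (metis of_nat_le_iff of_nat_power)
    moreover have "model_power p vs = 1 / real CARD('s) ^ n" if "vs \<in> I" for vs
      using mem(1)[OF that] by (simp add: model_power_def p_def map_replicate_const power_one_over)
    then have "(\<Sum>vs\<in>I. model_power p vs) = real (card I) / real CARD('s) ^ n"
      by simp
    ultimately show ?thesis
      by (simp add: divide_le_eq)
  qed
  then have "p \<in> CE_inf H"
    using p prob_models_FR_power[OF p] H \<open>finite V\<close> by (auto simp: CE_inf_def CE_def CE1_def)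
  then show ?thesis
    by (simp only: p_def H_def)
qed

section \<open>The two concrete scenarios\<close>

lemma nat_coded_dual_pairs:
  obtains V :: "nat set" and x y :: "nat \<Rightarrow> 's::finite \<Rightarrow> 'a::{finite,comm_ring_1}"
  where "finite V" "\<And>v. v \<in> V \<Longrightarrow> dot (x v) (y v) = 1"
    "\<And>f g. dot f g = 1 \<Longrightarrow> \<exists>v\<in>V. x v = f \<and> y v = g"
proof -
  define P where "P = {fg :: ('s \<Rightarrow> 'a) \<times> ('s \<Rightarrow> 'a). dot (fst fg) (snd fg) = 1}"
  obtain h where h: "bij_betw h {0..<card P} P"
    using ex_bij_betw_nat_finite[of P] by auto
  show ?thesis
  proof
    show "finite {0..<card P}" by simp
    show "dot ((fst \<circ> h) v) ((snd \<circ> h) v) = 1" if "v \<in> {0..<card P}" for v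
      using bij_betw_apply[OF h that] by (simp add: P_def)
    show "\<exists>v\<in>{0..<card P}. (fst \<circ> h) v = f \<and> (snd \<circ> h) v = g" if "dot f g = 1" for f g
    proof -
      have "(f, g) \<in> h ` {0..<card P}"
        using that bij_betw_imp_surj_on[OF h] by (simp add: P_def)
      then show ?thesis
        by (metis comp_apply fst_conv snd_conv imageE)
    qed
  qed
qed

text \<open>Modulo 2, and likewise modulo 3, every nonzero residue is its own inverse.\<close>

lemma inverse_mod_2: "z \<noteq> 0 \<Longrightarrow> \<exists>w. z * w = 1" for z :: 2
proof (cases z)
  case (of_int i)
  assume "z \<noteq> 0"
  with of_int have "i = 1"
    by (cases "i = 0") auto
  with of_int show ?thesis by simp
qed

lemma inverse_mod_3: "z \<noteq> 0 \<Longrightarrow> \<exists>w. z * w = 1" for z :: 3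
proof (cases z)
  case (of_int i)
  assume "z \<noteq> 0"
  with of_int have "i = 1 \<or> i = 2"
    by (cases "i = 0") auto
  with of_int have "z * z = 1" by auto
  then show ?thesis ..
qed

theorem theorem7p5p3:
  shows "\<exists>(HA :: nat hypergraph) (HB :: nat hypergraph).
           contextuality_scenario HA \<and> contextuality_scenario HB \<and>
           (\<exists>pA \<in> CE_inf HA. \<exists>pB \<in> CE_inf HB.
              model_product pA pB \<notin> CE1 (FR_product HA HB))"
proof -
  obtain VA and xA yA :: "nat \<Rightarrow> 10 \<Rightarrow> 2" where A: "finite VA" "\<And>v. v \<in> VA \<Longrightarrow> dot (xA v) (yA v) = 1"
    "\<And>f g. dot f g = 1 \<Longrightarrow> \<exists>v\<in>VA. xA v = f \<and> yA v = g"
    using nat_coded_dual_pairs by blast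
  \<comment> \<open>The index type has 11 elements; \<open>None\<close> is the additional
    coordinate, where all the vectors used below have entry 1.\<close>
  obtain VB and xB yB :: "nat \<Rightarrow> 10 option \<Rightarrow> 3" where B: "finite VB" "\<And>v. v \<in> VB \<Longrightarrow> dot (xB v) (yB v) = 1"
    "\<And>f g. dot f g = 1 \<Longrightarrow> \<exists>v\<in>VB. xB v = f \<and> yB v = g"
    using nat_coded_dual_pairs by blast
  define HA where "HA = basis_scenario xA yA VA"
  define HB where "HB = basis_scenario xB yB VB"
  define pA :: "nat \<Rightarrow> real" where "pA = (\<lambda>_. 1 / real CARD(10))"
  define pB :: "nat \<Rightarrow> real" where "pB = (\<lambda>_. 1 / real CARD(10 option))"
  have HA: "contextuality_scenario HA"
    unfolding HA_def by (rule contextuality_scenario_basis[OF inverse_mod_2 A(1,3,2)])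
  have HB: "contextuality_scenario HB"
    unfolding HB_def by (rule contextuality_scenario_basis[OF inverse_mod_3 B(1,3,2)])

  define T where "T = {t :: 10 set. card t = 3}"
  define ind :: "10 set \<Rightarrow> 10 \<Rightarrow> 2" where "ind t k = of_bool (k \<in> t)" for t k
  define f :: "10 set \<Rightarrow> 10 option \<Rightarrow> 3" where
    "f t k = (case k of None \<Rightarrow> 1 | Some i \<Rightarrow> of_bool (i \<in> t))" for t k
  define g :: "10 set \<Rightarrow> 10 option \<Rightarrow> 3" where
    "g t k = (case k of None \<Rightarrow> 1 | Some i \<Rightarrow> - of_bool (i \<in> t))" for t k
  \<comment> \<open>Modulo 2 this is 1 for \<open>s = t\<close> in \<open>T\<close>, where the
    overlap is 3, and 0 for overlaps 0 and 2.\<close>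
  have dot_ind: "dot (ind s) (ind t) = of_nat (card (s \<inter> t))" for s t
    by (simp add: dot_def ind_def Int_def flip: of_bool_conj)
  \<comment> \<open>\<open>None\<close> contributes the 1 and the sign in \<open>g\<close> subtracts
    the overlap. Modulo 3 the result is 1 for overlap 3 and 0 for overlap 1.\<close>
  have dot_fg: "dot (f s) (g t) = 1 - of_nat (card (s \<inter> t))" for s t
    by (simp add: dot_def f_def g_def UNIV_option_conv sum.reindex sum_negf Int_def flip: of_bool_conj)
  have "\<forall>t\<in>T. \<exists>v\<in>VA. xA v = ind t \<and> yA v = ind t"
    by (intro ballI A(3)) (simp add: dot_ind T_def)
  then obtain a where a: "a t \<in> VA" "xA (a t) = ind t" "yA (a t) = ind t" if "t \<in> T" for t
    by metis
  have "\<forall>t\<in>T. \<exists>v\<in>VB. xB v = f t \<and> yB v = g t"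
    by (intro ballI B(3)) (simp add: dot_fg T_def)
  then obtain b where b: "b t \<in> VB" "xB (b t) = f t" "yB (b t) = g t" if "t \<in> T" for t
    by metis
  define I where "I = (\<lambda>t. (a t, b t)) ` T"
  have inj_ind: "inj ind"
    by (rule injI) (auto simp: ind_def fun_eq_iff of_bool_eq_iff)
  have neq_a: "a s \<noteq> a t" if "s \<in> T" "t \<in> T" "s \<noteq> t" for s t
    using that a inj_ind by (metis injD)
  have neq_b: "b s \<noteq> b t" if "s \<in> T" "t \<in> T" "s \<noteq> t" for s t
  proof
    assume "b s = b t"
    then have "f s (Some i) = f t (Some i)" for i
      using b that by metis
    then show False
      using that by (auto simp: f_def of_bool_eq_iff)
  qed
  have I_sub: "I \<subseteq> verts (FR_product HA HB)"
    using a b by (auto simp: I_def FR_product_def HA_def HB_def basis_scenario_def)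
  have edge: "\<exists>e\<in>edges (FR_product HA HB). {(a s, b s), (a t, b t)} \<subseteq> e"
    if st: "s \<in> T" "t \<in> T" "s \<noteq> t" for s t
  proof -
    have "card (s \<inter> t) < 3"
      using st psubset_card_mono[of s "s \<inter> t"] unfolding T_def
      by (metis (mono_tags, lifting) Int_lower1 Int_lower2 card_subset_eq finite le_neq_implies_less card_mono mem_Collect_eq)
    \<comment> \<open>The field with 2 elements handles even overlaps through the first factor; the
      field with 3 elements handles overlap 1 through the second.\<close>
    then consider "card (s \<inter> t) \<in> {0, 2}" | "card (s \<inter> t) = 1"
      by fastforce
    then show ?thesis
    proof cases
      case 1
      then have "biorthogonal xA yA {a s, a t}"
        using st a A(2) neq_a[OF st] by (auto simp: biorthogonal_def dot_ind Int_commute T_def)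
      then obtain e where "e \<in> edges HA" "{a s, a t} \<subseteq> e"
        using biorthogonal_subset_edge[OF inverse_mod_2 A(1,3), of "{a s, a t}"] a st unfolding HA_def by auto
      then show ?thesis
        using FR_product_edge_left[OF HB, of "b s" "b t" e HA "a s" "a t"] st b neq_a[OF st]
        by (auto simp: HB_def basis_scenario_def)
    next
      case 2
      then have "biorthogonal xB yB {b s, b t}"
        using st b B(2) neq_b[OF st] by (auto simp: biorthogonal_def dot_fg Int_commute T_def)
      then obtain e where "e \<in> edges HB" "{b s, b t} \<subseteq> e"
        using biorthogonal_subset_edge[OF inverse_mod_3 B(1,3), of "{b s, b t}"] b st unfolding HB_def by auto
      then show ?thesis
        using FR_product_edge_right[OF HA, of "a s" "a t" e HB "b s" "b t"] st a neq_b[OF st]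
        by (auto simp: HA_def basis_scenario_def)
    qed
  qed
  have "indep I (NO_edges (FR_product HA HB))"
    using edge unfolding indep_def NO_edges_def I_def by (auto simp: doubleton_eq_iff)
  moreover have "card I = 120"
  proof -
    have "card T = 10 choose 3"
      using n_subsets[of "UNIV :: 10 set" 3] by (simp add: T_def)
    moreover have "inj_on (\<lambda>t. (a t, b t)) T"
      using neq_a by (auto intro: inj_onI)
    ultimately show ?thesis
      by (simp add: I_def card_image numeral_eq_Suc)
  qed
  \<comment> \<open>Each of the 120 vertices has weight \<open>1/10 * 1/11\<close>.\<close>
  then have "(\<Sum>v\<in>I. model_product pA pB v) = 120 / 110"
    by (simp add: model_product_def pA_def pB_def split_beta card_UNIV_option)
  ultimately have "model_product pA pB \<notin> CE1 (FR_product HA HB)"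
    using I_sub by (auto simp: CE1_def)
  moreover have "pA \<in> CE_inf HA" "pB \<in> CE_inf HB"
    unfolding pA_def HA_def pB_def HB_def using A B by (blast intro: uniform_in_CE_inf)+
  ultimately show ?thesis
    using HA HB by blast
qed

end
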